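(* Let $p:\mathbb{C}\to\mathbb{C}$ be a polynomial with simple zeros and let $D_p=\{(x,y,z)\in\mathbb{C}^3:xy=p(z)\}$. Consider the complete algebraic vector fields on $D_p$ $$\theta_1=x\frac{\partial}{\partial x}-y\frac{\partial}{\partial y},\qquad \theta_2=p'(z)\frac{\partial}{\partial x}+y\frac{\partial}{\partial z},\qquad \theta_3=p'(z)\frac{\partial}{\partial y}+x\frac{\partial}{\partial z}.$$ Then $(\theta_1,\theta_2,\theta_3)$ is a compatible $3$-tuple.
   Context: $\mathbb{C}[X]$ is the algebra of regular functions on an algebraic manifold (smooth complex algebraic variety) $X$. A vector field is complete if its flow is defined for all complex times and all initial points. For an algebraic vector field $\theta$, $\ker\theta=\{f\in\mathbb{C}[X]:\theta(f)=0\}$ and $\ker\theta^2=\{f:\theta(\theta(f))=0\}$. An ordered $n$-tuple $(\theta_1,\dots,\theta_n)$ of complete algebraic vector fields on $X$ is compatible if (i) there is a triple $(G,\pi,\epsilon)$ where $G$ is a finite rooted directed tree with edges oriented towards the root, $\pi:\mathrm{Vert}(G)\to\{\theta_1,\dots,\theta_n\}$ is a bijection with $\pi(\mathrm{root})=\theta_1$, and $\epsilon:\mathrm{Edge}(G)\to\mathbb{C}[X]$ satisfies $\epsilon(v,w)\in(\ker\pi(v)^2\setminus\ker\pi(v))\cap\ker\pi(w)$ for every edge $(v,w)$ from $v$ to $w$; (ii) there is a non-zero ideal $I\subset\mathbb{C}[X]$ contained in the linear span of $\{f_1\cdots f_n:f_i\in\ker\theta_i\}$. *)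

theory Defs
  imports
    "HOL-Analysis.Analysis"
    "HOL-Computational_Algebra.Polynomial"
    "HOL-Algebra.Ideal"
    "Graph_Theory.Pair_Digraph"
begin

section \<open>Affine algebraic manifolds and their regular functions\<close>

text \<open>The complex analogue of the library's \<open>real_polynomial_function\<close>.\<close>

inductive complex_polynomial_function :: "(complex ^ 'n \<Rightarrow> complex) \<Rightarrow> bool" where
  const: "complex_polynomial_function (\<lambda>x. c)"
| coord: "complex_polynomial_function (\<lambda>x. x $ i)"
| add: "\<lbrakk>complex_polynomial_function f; complex_polynomial_function g\<rbrakk>
    \<Longrightarrow> complex_polynomial_function (\<lambda>x. f x + g x)"
| mult: "\<lbrakk>complex_polynomial_function f; complex_polynomial_function g\<rbrakk>
    \<Longrightarrow> complex_polynomial_function (\<lambda>x. f x * g x)"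

text \<open>The complex partial derivative \<open>\<partial>f/\<partial>x\<^sub>i\<close> at \<open>x\<close>.\<close>

definition partial_deriv ::
    "'n::finite \<Rightarrow> (complex ^ 'n \<Rightarrow> complex) \<Rightarrow> complex ^ 'n \<Rightarrow> complex" where
  "partial_deriv i f x = deriv (\<lambda>t. f (x + axis i t)) 0"

definition vanishing_ideal :: "(complex ^ 'n) set \<Rightarrow> (complex ^ 'n \<Rightarrow> complex) set" where
  "vanishing_ideal X = {f. complex_polynomial_function f \<and> (\<forall>x\<in>X. f x = 0)}"

definition affine_algebraic_set :: "(complex ^ 'n) set \<Rightarrow> bool" where
  "affine_algebraic_set X \<longleftrightarrow>
     (\<exists>S. (\<forall>f\<in>S. complex_polynomial_function f) \<and> X = {x. \<forall>f\<in>S. f x = 0})"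

text \<open>Jacobian criterion: near \<open>x\<close>, the set \<open>X\<close> is cut out by finitely many elements of its
  vanishing ideal whose gradients at \<open>x\<close> are linearly independent over the complex numbers.\<close>

definition smooth_point :: "(complex ^ 'n::finite) set \<Rightarrow> complex ^ 'n \<Rightarrow> bool" where
  "smooth_point X x \<longleftrightarrow>
     (\<exists>U T. open U \<and> x \<in> U \<and> finite T \<and> T \<subseteq> vanishing_ideal X \<and>
        X \<inter> U = {y \<in> U. \<forall>f\<in>T. f y = 0} \<and>
        (\<forall>c. (\<forall>i. (\<Sum>f\<in>T. c f * partial_deriv i f x) = 0) \<longrightarrow> (\<forall>f\<in>T. c f = 0)))"

definition algebraic_manifold :: "(complex ^ 'n::finite) set \<Rightarrow> bool" where
  "algebraic_manifold X \<longleftrightarrow> affine_algebraic_set X \<and> (\<forall>x\<in>X. smooth_point X x)"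

text \<open>Functions and vector fields on \<open>X\<close> are extensional (\<open>undefined\<close> off \<open>X\<close>), so that two of
  them are equal iff they agree on \<open>X\<close>.\<close>

definition regular_functions :: "(complex ^ 'n) set \<Rightarrow> (complex ^ 'n \<Rightarrow> complex) set" where
  "regular_functions X = {restrict f X | f. complex_polynomial_function f}"

definition regular_ring :: "(complex ^ 'n) set \<Rightarrow> (complex ^ 'n \<Rightarrow> complex) ring" where
  "regular_ring X =
     \<lparr>carrier = regular_functions X,
      mult = (\<lambda>f g. \<lambda>x\<in>X. f x * g x),
      one = (\<lambda>x\<in>X. 1),
      zero = (\<lambda>x\<in>X. 0),
      add = (\<lambda>f g. \<lambda>x\<in>X. f x + g x)\<rparr>"

definition linear_span_on ::
    "(complex ^ 'n) set \<Rightarrow> (complex ^ 'n \<Rightarrow> complex) set \<Rightarrow> (complex ^ 'n \<Rightarrow> complex) set" where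
  "linear_span_on X S = {\<lambda>x\<in>X. \<Sum>f\<in>T. c f * f x | T c. finite T \<and> T \<subseteq> S}"


section \<open>Complete algebraic vector fields\<close>

text \<open>A vector field is given by its coefficients, so \<open>\<theta> x $ i\<close> is the coefficient of
  \<open>\<partial>/\<partial>x\<^sub>i\<close> at \<open>x\<close>; the last conjunct is tangency to \<open>X\<close>.\<close>

definition algebraic_vector_field ::
    "(complex ^ 'n::finite) set \<Rightarrow> (complex ^ 'n \<Rightarrow> complex ^ 'n) \<Rightarrow> bool" where
  "algebraic_vector_field X \<theta> \<longleftrightarrow>
     \<theta> \<in> extensional X \<and>
     (\<forall>i. (\<lambda>x\<in>X. \<theta> x $ i) \<in> regular_functions X) \<and>
     (\<forall>F\<in>vanishing_ideal X. \<forall>x\<in>X. (\<Sum>i\<in>UNIV. \<theta> x $ i * partial_deriv i F x) = 0)"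

text \<open>The action of \<open>\<theta>\<close> on a regular function is computed on a polynomial representative; for
  \<open>\<theta>\<close> tangent to \<open>X\<close> the result does not depend on which one is chosen.\<close>

definition vf_apply ::
    "(complex ^ 'n::finite) set \<Rightarrow> (complex ^ 'n \<Rightarrow> complex ^ 'n) \<Rightarrow>
     (complex ^ 'n \<Rightarrow> complex) \<Rightarrow> complex ^ 'n \<Rightarrow> complex" where
  "vf_apply X \<theta> f =
     (let F = (SOME F. complex_polynomial_function F \<and> restrict F X = f)
      in (\<lambda>x\<in>X. \<Sum>i\<in>UNIV. \<theta> x $ i * partial_deriv i F x))"

definition vf_ker ::
    "(complex ^ 'n::finite) set \<Rightarrow> (complex ^ 'n \<Rightarrow> complex ^ 'n) \<Rightarrow>
     (complex ^ 'n \<Rightarrow> complex) set" where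
  "vf_ker X \<theta> = {f \<in> regular_functions X. vf_apply X \<theta> f = (\<lambda>x\<in>X. 0)}"

definition vf_ker2 ::
    "(complex ^ 'n::finite) set \<Rightarrow> (complex ^ 'n \<Rightarrow> complex ^ 'n) \<Rightarrow>
     (complex ^ 'n \<Rightarrow> complex) set" where
  "vf_ker2 X \<theta> = {f \<in> regular_functions X. vf_apply X \<theta> (vf_apply X \<theta> f) = (\<lambda>x\<in>X. 0)}"

text \<open>Completeness: through every point of \<open>X\<close> there is an integral curve in \<open>X\<close> defined for all
  complex times.\<close>

definition complete_vector_field ::
    "(complex ^ 'n::finite) set \<Rightarrow> (complex ^ 'n \<Rightarrow> complex ^ 'n) \<Rightarrow> bool" where
  "complete_vector_field X \<theta> \<longleftrightarrow>
     (\<forall>x\<in>X. \<exists>\<phi> :: complex \<Rightarrow> complex ^ 'n.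
        \<phi> 0 = x \<and> (\<forall>t. \<phi> t \<in> X) \<and>
        (\<forall>t i. ((\<lambda>s. \<phi> s $ i) has_field_derivative \<theta> (\<phi> t) $ i) (at t)))"


section \<open>Compatible tuples\<close>

text \<open>A digraph is a tree with all edges oriented towards the root \<open>r\<close> iff every vertex has
  exactly one directed walk to \<open>r\<close>.\<close>

definition finite_tree_to_root :: "'v pair_pre_digraph \<Rightarrow> 'v \<Rightarrow> bool" where
  "finite_tree_to_root G r \<longleftrightarrow>
     pair_fin_digraph G \<and> r \<in> pverts G \<and>
     (\<forall>v\<in>pverts G. \<exists>!w. pre_digraph.awalk (with_proj G) v w r)"

text \<open>Since the graph is finite, its vertices may be taken to be natural numbers.\<close>

definition compatible_tuple ::
    "(complex ^ 'n::finite) set \<Rightarrow> (complex ^ 'n \<Rightarrow> complex ^ 'n) list \<Rightarrow> bool" where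
  "compatible_tuple X \<theta>s \<longleftrightarrow>
     algebraic_manifold X \<and>
     (\<forall>\<theta>\<in>set \<theta>s. algebraic_vector_field X \<theta> \<and> complete_vector_field X \<theta>) \<and>
     (\<exists>(G :: nat pair_pre_digraph) r \<pi> \<epsilon>.
        finite_tree_to_root G r \<and>
        bij_betw \<pi> (pverts G) (set \<theta>s) \<and> \<pi> r = hd \<theta>s \<and>
        (\<forall>(v, w)\<in>parcs G.
           \<epsilon> (v, w) \<in> (vf_ker2 X (\<pi> v) - vf_ker X (\<pi> v)) \<inter> vf_ker X (\<pi> w))) \<and>
     (\<exists>I. ideal I (regular_ring X) \<and> I \<noteq> {\<zero>\<^bsub>regular_ring X\<^esub>} \<and>
        I \<subseteq> linear_span_on X
              {\<lambda>x\<in>X. \<Prod>i<length \<theta>s. f i x | f. \<forall>i<length \<theta>s. f i \<in> vf_ker X (\<theta>s ! i)})"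


section \<open>The Danielewski surface \<open>xy = p(z)\<close>\<close>

definition danielewski :: "complex poly \<Rightarrow> (complex ^ 3) set" where
  "danielewski p = {v. v $ 1 * v $ 2 = poly p (v $ 3)}"

definition theta1 :: "complex poly \<Rightarrow> complex ^ 3 \<Rightarrow> complex ^ 3" where
  "theta1 p = (\<lambda>v\<in>danielewski p. vector [v $ 1, - v $ 2, 0])"

definition theta2 :: "complex poly \<Rightarrow> complex ^ 3 \<Rightarrow> complex ^ 3" where
  "theta2 p = (\<lambda>v\<in>danielewski p. vector [poly (pderiv p) (v $ 3), 0, v $ 2])"

definition theta3 :: "complex poly \<Rightarrow> complex ^ 3 \<Rightarrow> complex ^ 3" where
  "theta3 p = (\<lambda>v\<in>danielewski p. vector [0, poly (pderiv p) (v $ 3), v $ 1])"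

end

theory Submission
  imports Defs
begin

text \<open>The coordinate functions \<open>z\<close>, \<open>y\<close>, \<open>x\<close> lie in the kernels of \<open>\<theta>\<^sub>1\<close>, \<open>\<theta>\<^sub>2\<close>, \<open>\<theta>\<^sub>3\<close>. Kernels are
  subalgebras, so the products \<open>f\<^sub>1 f\<^sub>2 f\<^sub>3\<close> include all monomials and span the whole algebra of regular
  functions, which therefore serves as the ideal. The tree has the two edges
  \<open>\<theta>\<^sub>2 \<rightarrow> \<theta>\<^sub>1\<close> and \<open>\<theta>\<^sub>3 \<rightarrow> \<theta>\<^sub>1\<close>, both labelled by \<open>z\<close>, since \<open>\<theta>\<^sub>2 z = y\<close> and \<open>\<theta>\<^sub>3 z = x\<close> are
  killed by \<open>\<theta>\<^sub>2\<close> and \<open>\<theta>\<^sub>3\<close>. Integral curves are explicit, and tangency follows from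
  their existence by differentiating \<open>F \<circ> \<phi> = 0\<close>.\<close>

section \<open>Derivatives of polynomial functions\<close>

text \<open>The sum and product rules for \<open>deriv\<close>, hence for
  \<open>partial_deriv\<close>, require differentiability. It is inherited along the construction of
  a polynomial function, since each coordinate is constant or affine along an axis.\<close>

lemma field_differentiable_along_axis:
  assumes "complex_polynomial_function f"
  shows "(\<lambda>t. f (x + axis i t)) field_differentiable at 0"
  using assms
proof induction
  case (coord j)
  then show ?case
    by (cases "i = j") (auto simp: axis_def intro!: derivative_intros)
qed (auto intro!: derivative_intros)

lemma partial_deriv_const [simp]: "partial_deriv i (\<lambda>x. c) x = 0"
  by (simp add: partial_deriv_def)

lemma partial_deriv_poly_coord:
  "partial_deriv i (\<lambda>v. poly p (v $ j)) x = (if i = j then poly (pderiv p) (x $ j) else 0)"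
  unfolding partial_deriv_def
  by (auto simp: axis_def intro!: DERIV_imp_deriv derivative_eq_intros)

lemma partial_deriv_coord [simp]: "partial_deriv i (\<lambda>v. v $ j) x = (if i = j then 1 else 0)"
  using partial_deriv_poly_coord[of i "[:0, 1:]" j x] by (simp add: pderiv_pCons)

lemma partial_deriv_add:
  assumes "complex_polynomial_function f" "complex_polynomial_function g"
  shows "partial_deriv i (\<lambda>x. f x + g x) x = partial_deriv i f x + partial_deriv i g x"
  unfolding partial_deriv_def
  by (intro deriv_add field_differentiable_along_axis assms)

lemma partial_deriv_diff:
  assumes "complex_polynomial_function f" "complex_polynomial_function g"
  shows "partial_deriv i (\<lambda>x. f x - g x) x = partial_deriv i f x - partial_deriv i g x"
  unfolding partial_deriv_def
  by (intro deriv_diff field_differentiable_along_axis assms)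

lemma partial_deriv_mult:
  assumes "complex_polynomial_function f" "complex_polynomial_function g"
  shows "partial_deriv i (\<lambda>x. f x * g x) x = f x * partial_deriv i g x + partial_deriv i f x * g x"
proof -
  \<comment> \<open>The product rule evaluates the factors at \<open>x + axis i 0\<close>, which has
    to collapse to \<open>x\<close>.\<close>
  have axis_0: "axis i (0::complex) = 0"
    by (simp add: axis_def vec_eq_iff)
  show ?thesis
    unfolding partial_deriv_def
    using deriv_mult[OF field_differentiable_along_axis[OF assms(1), of x i]
        field_differentiable_along_axis[OF assms(2), of x i]]
    by (simp add: axis_0)
qed

text \<open>With \<open>w = \<theta> x\<close> this is the value at \<open>x\<close> of the
  derivation \<theta> applied to \<open>f\<close>, the sum occurring both in \<open>vf_apply\<close>
  and in the tangency condition.\<close>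

definition directional_deriv ::
    "complex ^ 'n::finite \<Rightarrow> (complex ^ 'n \<Rightarrow> complex) \<Rightarrow> complex ^ 'n \<Rightarrow> complex" where
  "directional_deriv w f x = (\<Sum>i\<in>UNIV. w $ i * partial_deriv i f x)"

lemma directional_deriv_const [simp]: "directional_deriv w (\<lambda>x. c) x = 0"
  by (simp add: directional_deriv_def)

lemma directional_deriv_coord [simp]: "directional_deriv w (\<lambda>v. v $ j) x = w $ j"
  by (simp add: directional_deriv_def if_distrib[of "(*) _"] cong: if_cong)

lemma directional_deriv_add:
  assumes "complex_polynomial_function f" "complex_polynomial_function g"
  shows "directional_deriv w (\<lambda>x. f x + g x) x = directional_deriv w f x + directional_deriv w g x"
  by (simp add: directional_deriv_def partial_deriv_add[OF assms] algebra_simps sum.distrib)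

lemma directional_deriv_diff:
  assumes "complex_polynomial_function f" "complex_polynomial_function g"
  shows "directional_deriv w (\<lambda>x. f x - g x) x = directional_deriv w f x - directional_deriv w g x"
  by (simp add: directional_deriv_def partial_deriv_diff[OF assms] algebra_simps sum_subtractf)

lemma directional_deriv_mult:
  assumes "complex_polynomial_function f" "complex_polynomial_function g"
  shows "directional_deriv w (\<lambda>x. f x * g x) x =
    f x * directional_deriv w g x + directional_deriv w f x * g x"
  by (simp add: directional_deriv_def partial_deriv_mult[OF assms] algebra_simps sum.distrib
      sum_distrib_left)

text \<open>The chain rule. Both sides obey the same sum and Leibniz rules, so induction on
  \<open>f\<close> reduces it to constants and to coordinates, where it is the assumption on the
  curve.\<close>

lemma has_field_derivative_along_curve:
  assumes "complex_polynomial_function f"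
    and "\<And>i. ((\<lambda>s. \<phi> s $ i) has_field_derivative w $ i) (at t)"
  shows "((\<lambda>s. f (\<phi> s)) has_field_derivative directional_deriv w f (\<phi> t)) (at t)"
  using assms(1)
proof induction
  case (add f g)
  then show ?case
    by (auto simp: directional_deriv_add intro!: derivative_eq_intros)
next
  case (mult f g)
  then show ?case
    by (auto simp: directional_deriv_mult intro!: derivative_eq_intros)
qed (auto simp: assms(2))

section \<open>The algebra of regular functions\<close>

lemma complex_polynomial_function_diff:
  assumes "complex_polynomial_function f" "complex_polynomial_function g"
  shows "complex_polynomial_function (\<lambda>x. f x - g x)"
  using complex_polynomial_function.add[OF assms(1)
      complex_polynomial_function.mult[OF complex_polynomial_function.const[of "-1"] assms(2)]]
  by simp

lemma complex_polynomial_function_poly: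
  assumes "complex_polynomial_function f"
  shows "complex_polynomial_function (\<lambda>x. poly p (f x))"
  by (induction p) (auto intro!: complex_polynomial_function.intros assms)

lemma regular_functionsI:
  "complex_polynomial_function f \<Longrightarrow> restrict f X \<in> regular_functions X"
  by (auto simp: regular_functions_def)

lemma regular_functionsE:
  assumes "f \<in> regular_functions X"
  obtains F where "complex_polynomial_function F" "f = restrict F X"
  using assms by (auto simp: regular_functions_def)

lemma regular_functions_const: "(\<lambda>x\<in>X. c) \<in> regular_functions X"
  by (intro regular_functionsI complex_polynomial_function.intros)

lemma regular_functions_add:
  assumes "f \<in> regular_functions X" "g \<in> regular_functions X"
  shows "(\<lambda>x\<in>X. f x + g x) \<in> regular_functions X"
proof -
  obtain F G where "complex_polynomial_function F" "f = restrict F X"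
    "complex_polynomial_function G" "g = restrict G X"
    using assms by (metis regular_functionsE)
  then show ?thesis
    using regular_functionsI[OF complex_polynomial_function.add, of F G X]
    by (simp cong: restrict_cong)
qed

lemma regular_functions_mult:
  assumes "f \<in> regular_functions X" "g \<in> regular_functions X"
  shows "(\<lambda>x\<in>X. f x * g x) \<in> regular_functions X"
proof -
  obtain F G where "complex_polynomial_function F" "f = restrict F X"
    "complex_polynomial_function G" "g = restrict G X"
    using assms by (metis regular_functionsE)
  then show ?thesis
    using regular_functionsI[OF complex_polynomial_function.mult, of F G X]
    by (simp cong: restrict_cong)
qed

lemma regular_functions_extensional: "f \<in> regular_functions X \<Longrightarrow> restrict f X = f"
  by (auto elim!: regular_functionsE)

text \<open>Makes the whole carrier available as an ideal, via \<open>ring.oneideal\<close>.\<close>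

lemma ring_regular_ring: "ring (regular_ring X)"
proof (rule ringI)
  show "abelian_group (regular_ring X)"
  proof (rule abelian_groupI)
    fix f assume "f \<in> carrier (regular_ring X)"
    then have f: "f \<in> regular_functions X"
      by (simp add: regular_ring_def)
    \<comment> \<open>The additive inverse is built as a product with the constant -1, so that
      closure under multiplication shows it to be regular.\<close>
    have "(\<lambda>x\<in>X. (\<lambda>x\<in>X. -1) x * f x) \<in> regular_functions X"
      by (intro regular_functions_mult regular_functions_const f)
    then show "\<exists>g\<in>carrier (regular_ring X). g \<oplus>\<^bsub>regular_ring X\<^esub> f = \<zero>\<^bsub>regular_ring X\<^esub>"
      by (intro bexI[of _ "\<lambda>x\<in>X. (\<lambda>x\<in>X. -1) x * f x"])
        (auto simp: regular_ring_def cong: restrict_cong)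
  qed (auto simp: regular_ring_def regular_functions_const regular_functions_add
      regular_functions_extensional add_ac cong: restrict_cong)
  show "monoid (regular_ring X)"
    by (rule monoidI)
      (auto simp: regular_ring_def regular_functions_const regular_functions_mult
        regular_functions_extensional mult_ac cong: restrict_cong)
qed (simp_all add: regular_ring_def distrib_left distrib_right cong: restrict_cong)

section \<open>Linear spans\<close>

lemma linear_span_on_base:
  assumes "f \<in> S" "f \<in> extensional X"
  shows "f \<in> linear_span_on X S"
  unfolding linear_span_on_def
  by (intro CollectI exI[of _ "\<lambda>_. 1"] exI[of _ "{f}"])
    (simp add: assms extensional_restrict)

lemma linear_span_on_scale:
  assumes "f \<in> linear_span_on X S"
  shows "(\<lambda>x\<in>X. a * f x) \<in> linear_span_on X S"
proof -
  obtain T c where "finite T" "T \<subseteq> S" "f = (\<lambda>x\<in>X. \<Sum>g\<in>T. c g * g x)"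
    using assms by (auto simp: linear_span_on_def)
  then show ?thesis
    unfolding linear_span_on_def
    by (intro CollectI exI[of _ T] exI[of _ "\<lambda>g. a * c g"])
      (auto simp: sum_distrib_left mult.assoc cong: restrict_cong)
qed

lemma linear_span_on_add:
  assumes "f \<in> linear_span_on X S" "g \<in> linear_span_on X S"
  shows "(\<lambda>x\<in>X. f x + g x) \<in> linear_span_on X S"
proof -
  obtain T c where T: "finite T" "T \<subseteq> S" "f = (\<lambda>x\<in>X. \<Sum>h\<in>T. c h * h x)"
    using assms(1) by (auto simp: linear_span_on_def)
  obtain U d where U: "finite U" "U \<subseteq> S" "g = (\<lambda>x\<in>X. \<Sum>h\<in>U. d h * h x)"
    using assms(2) by (auto simp: linear_span_on_def)
  \<comment> \<open>Both combinations are extended by zero coefficients to the common support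
    \<open>T \<union> U\<close>.\<close>
  have "(\<Sum>h\<in>T. c h * h x) = (\<Sum>h\<in>T \<union> U. (if h \<in> T then c h else 0) * h x)"
    "(\<Sum>h\<in>U. d h * h x) = (\<Sum>h\<in>T \<union> U. (if h \<in> U then d h else 0) * h x)" for x
    using T(1) U(1) by (auto intro!: sum.mono_neutral_cong_left)
  then have "(\<lambda>x\<in>X. f x + g x) = (\<lambda>x\<in>X. \<Sum>h\<in>T \<union> U.
      ((if h \<in> T then c h else 0) + (if h \<in> U then d h else 0)) * h x)"
    unfolding T(3) U(3) by (simp add: distrib_right sum.distrib cong: restrict_cong)
  moreover have "finite (T \<union> U)" "T \<union> U \<subseteq> S"
    using T U by auto
  ultimately show ?thesis
    unfolding linear_span_on_def
    by (intro CollectI exI[of _ "T \<union> U"]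
        exI[of _ "\<lambda>h. (if h \<in> T then c h else 0) + (if h \<in> U then d h else 0)"] conjI)
qed

text \<open>In \<open>linear_span_on\<close> the sum runs over a set of functions; here it runs over
  an index set on which \<open>g\<close> may repeat values. Adding one term at a time merges the
  coefficients of repeated functions.\<close>

lemma linear_span_on_sum:
  assumes "\<And>a. a \<in> A \<Longrightarrow> g a \<in> linear_span_on X S"
  shows "(\<lambda>x\<in>X. \<Sum>a\<in>A. c a * g a x) \<in> linear_span_on X S"
proof -
  \<comment> \<open>The empty combination settles the empty index set and also infinite ones, whose
    sum is 0 by convention.\<close>
  have zero: "(\<lambda>x\<in>X. 0) \<in> linear_span_on X S"
    unfolding linear_span_on_def by (intro CollectI exI[of _ "{}"]) auto
  show ?thesis
    using assms
  proof (induction A rule: infinite_finite_induct)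
    case (insert a A)
    then have "(\<lambda>x\<in>X. (\<lambda>x\<in>X. c a * g a x) x + (\<lambda>x\<in>X. \<Sum>a\<in>A. c a * g a x) x)
        \<in> linear_span_on X S"
      by (intro linear_span_on_add linear_span_on_scale) auto
    also have "(\<lambda>x\<in>X. (\<lambda>x\<in>X. c a * g a x) x + (\<lambda>x\<in>X. \<Sum>a\<in>A. c a * g a x) x) =
        (\<lambda>x\<in>X. \<Sum>a\<in>insert a A. c a * g a x)"
      using insert.hyps by (intro restrict_ext) simp
    finally show ?case .
  qed (simp_all add: zero)
qed

text \<open>The product expands into a double sum over \<open>T \<times> U\<close>. Different pairs
  may have the same product, so the sum is handled as an indexed family.\<close>

lemma linear_span_on_mult:
  assumes S: "\<And>f g. f \<in> S \<Longrightarrow> g \<in> S \<Longrightarrow> (\<lambda>x\<in>X. f x * g x) \<in> S"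
    and "f \<in> linear_span_on X S" "g \<in> linear_span_on X S"
  shows "(\<lambda>x\<in>X. f x * g x) \<in> linear_span_on X S"
proof -
  obtain T c where T: "T \<subseteq> S" "f = (\<lambda>x\<in>X. \<Sum>h\<in>T. c h * h x)"
    using assms(2) by (auto simp: linear_span_on_def)
  obtain U d where U: "U \<subseteq> S" "g = (\<lambda>x\<in>X. \<Sum>h\<in>U. d h * h x)"
    using assms(3) by (auto simp: linear_span_on_def)
  have "(\<lambda>x\<in>X. f x * g x) =
      (\<lambda>x\<in>X. \<Sum>(a, b)\<in>T \<times> U. (c a * d b) * (\<lambda>x\<in>X. a x * b x) x)"
    unfolding T(2) U(2)
    by (simp add: sum_product sum.cartesian_product mult_ac cong: restrict_cong)
  moreover have "(\<lambda>x\<in>X. \<Sum>q\<in>T \<times> U. (c (fst q) * d (snd q)) * (\<lambda>x\<in>X. fst q x * snd q x) x)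
      \<in> linear_span_on X S"
  proof (rule linear_span_on_sum)
    fix q assume "q \<in> T \<times> U"
    then have "(\<lambda>x\<in>X. fst q x * snd q x) \<in> S"
      using T(1) U(1) by (intro S) auto
    then show "(\<lambda>x\<in>X. fst q x * snd q x) \<in> linear_span_on X S"
      by (rule linear_span_on_base) (rule restrict_extensional)
  qed
  ultimately show ?thesis
    by (simp add: case_prod_unfold)
qed

section \<open>Kernels of vector fields\<close>

lemma algebraic_vector_field_if_complete:
  assumes "\<theta> \<in> extensional X" "\<And>i. (\<lambda>x\<in>X. \<theta> x $ i) \<in> regular_functions X"
    and "complete_vector_field X \<theta>"
  shows "algebraic_vector_field X \<theta>"
  unfolding algebraic_vector_field_def
proof (intro conjI allI ballI assms)
  fix F x assume F: "F \<in> vanishing_ideal X" and x: "x \<in> X"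
  obtain \<phi> where \<phi>: "\<phi> 0 = x" "\<And>t. \<phi> t \<in> X"
    "\<And>t i. ((\<lambda>s. \<phi> s $ i) has_field_derivative \<theta> (\<phi> t) $ i) (at t)"
    using assms(3) x unfolding complete_vector_field_def by blast
  have "((\<lambda>s. F (\<phi> s)) has_field_derivative directional_deriv (\<theta> (\<phi> 0)) F (\<phi> 0)) (at 0)"
    using F \<phi>(3) by (intro has_field_derivative_along_curve) (auto simp: vanishing_ideal_def)
  moreover have "(\<lambda>s. F (\<phi> s)) = (\<lambda>s. 0)"
    using F \<phi>(2) by (auto simp: vanishing_ideal_def)
  ultimately have "directional_deriv (\<theta> x) F x = 0"
    using DERIV_unique[OF _ DERIV_const, of 0 _ 0] by (simp add: \<phi>(1))
  then show "(\<Sum>i\<in>UNIV. \<theta> x $ i * partial_deriv i F x) = 0"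
    by (simp add: directional_deriv_def)
qed

text \<open>The representative chosen by \<open>SOME\<close> may be replaced by any other: their
  difference lies in the vanishing ideal, which a tangent field kills at every point of
  \<open>X\<close>.\<close>

lemma vf_apply_restrict:
  assumes "algebraic_vector_field X \<theta>" "complex_polynomial_function F"
  shows "vf_apply X \<theta> (restrict F X) = (\<lambda>x\<in>X. directional_deriv (\<theta> x) F x)"
proof -
  define G where "G = (SOME G. complex_polynomial_function G \<and> restrict G X = restrict F X)"
  have "complex_polynomial_function G \<and> restrict G X = restrict F X"
    unfolding G_def by (rule someI[of _ F]) (simp add: assms(2))
  then have G: "complex_polynomial_function G" and eq: "\<And>x. x \<in> X \<Longrightarrow> G x = F x"
    by (simp, metis restrict_apply')
  have "(\<lambda>x. F x - G x) \<in> vanishing_ideal X"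
    using complex_polynomial_function_diff[OF assms(2) G] eq by (auto simp: vanishing_ideal_def)
  then have "directional_deriv (\<theta> x) (\<lambda>x. F x - G x) x = 0" if "x \<in> X" for x
    using assms(1) that unfolding algebraic_vector_field_def directional_deriv_def by blast
  then have "directional_deriv (\<theta> x) F x = directional_deriv (\<theta> x) G x" if "x \<in> X" for x
    using that by (simp add: directional_deriv_diff[OF assms(2) G])
  then show ?thesis
    unfolding vf_apply_def G_def[symmetric] Let_def
    by (simp add: directional_deriv_def cong: restrict_cong)
qed

lemma restrict_in_vf_ker_iff:
  assumes "algebraic_vector_field X \<theta>" "complex_polynomial_function F"
  shows "restrict F X \<in> vf_ker X \<theta> \<longleftrightarrow> (\<forall>x\<in>X. directional_deriv (\<theta> x) F x = 0)"
proof -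
  have "restrict F X \<in> vf_ker X \<theta> \<longleftrightarrow>
      (\<lambda>x\<in>X. directional_deriv (\<theta> x) F x) = (\<lambda>x\<in>X. 0)"
    by (simp add: vf_ker_def vf_apply_restrict[OF assms] regular_functionsI[OF assms(2)])
  also have "\<dots> \<longleftrightarrow> (\<forall>x\<in>X. directional_deriv (\<theta> x) F x = 0)"
    by (auto simp: restrict_def fun_eq_iff)
  finally show ?thesis .
qed

lemma vf_kerE:
  assumes "algebraic_vector_field X \<theta>" "f \<in> vf_ker X \<theta>"
  obtains F where "complex_polynomial_function F" "f = restrict F X"
    "\<And>x. x \<in> X \<Longrightarrow> directional_deriv (\<theta> x) F x = 0"
proof -
  from assms(2) obtain F where "complex_polynomial_function F" "f = restrict F X"
    by (auto simp: vf_ker_def elim: regular_functionsE)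
  with that assms show ?thesis
    using restrict_in_vf_ker_iff by blast
qed

lemma vf_ker_const:
  assumes "algebraic_vector_field X \<theta>"
  shows "(\<lambda>x\<in>X. c) \<in> vf_ker X \<theta>"
  by (simp add: restrict_in_vf_ker_iff[OF assms] complex_polynomial_function.const)

lemma vf_ker_mult:
  assumes "algebraic_vector_field X \<theta>" "f \<in> vf_ker X \<theta>" "g \<in> vf_ker X \<theta>"
  shows "(\<lambda>x\<in>X. f x * g x) \<in> vf_ker X \<theta>"
proof -
  obtain F G where F: "complex_polynomial_function F" "f = restrict F X"
      "\<And>x. x \<in> X \<Longrightarrow> directional_deriv (\<theta> x) F x = 0"
    and G: "complex_polynomial_function G" "g = restrict G X"
      "\<And>x. x \<in> X \<Longrightarrow> directional_deriv (\<theta> x) G x = 0"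
    using assms by (metis vf_kerE)
  have "(\<lambda>x\<in>X. F x * G x) \<in> vf_ker X \<theta>"
    by (subst restrict_in_vf_ker_iff[OF assms(1)])
      (auto simp: F G directional_deriv_mult intro: complex_polynomial_function.mult)
  then show ?thesis
    by (simp add: F(2) G(2) cong: restrict_cong)
qed

text \<open>The set \<open>S\<close> of kernel products is closed under multiplication and contains
  1, so its span is an algebra. It also contains every single kernel, hence the coordinates, and
  these generate all regular functions.\<close>

lemma regular_functions_subset_span_ker_products:
  assumes vf: "\<And>\<theta>. \<theta> \<in> set \<theta>s \<Longrightarrow> algebraic_vector_field X \<theta>"
    and coord: "\<And>j. \<exists>\<theta>\<in>set \<theta>s. (\<lambda>x\<in>X. x $ j) \<in> vf_ker X \<theta>"
  shows "regular_functions X \<subseteq> linear_span_on X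
    {\<lambda>x\<in>X. \<Prod>i<length \<theta>s. f i x | f. \<forall>i<length \<theta>s. f i \<in> vf_ker X (\<theta>s ! i)}"
    (is "_ \<subseteq> linear_span_on X ?R")
proof -
  define S where "S = ?R"
  have SI: "(\<lambda>x\<in>X. \<Prod>i<length \<theta>s. f i x) \<in> S"
    if "\<And>i. i < length \<theta>s \<Longrightarrow> f i \<in> vf_ker X (\<theta>s ! i)" for f
    using that unfolding S_def by blast
  have S_mult: "(\<lambda>x\<in>X. f x * g x) \<in> S" if fg: "f \<in> S" "g \<in> S" for f g
  proof -
    obtain a b where a: "f = (\<lambda>x\<in>X. \<Prod>i<length \<theta>s. a i x)"
        "\<forall>i<length \<theta>s. a i \<in> vf_ker X (\<theta>s ! i)"
      and b: "g = (\<lambda>x\<in>X. \<Prod>i<length \<theta>s. b i x)" "\<forall>i<length \<theta>s. b i \<in> vf_ker X (\<theta>s ! i)"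
      using fg unfolding S_def by blast
    \<comment> \<open>By commutativity the factors are regrouped slot by slot, each slot staying in
      its own kernel.\<close>
    have "(\<lambda>x\<in>X. f x * g x) = (\<lambda>x\<in>X. \<Prod>i<length \<theta>s. (\<lambda>x\<in>X. a i x * b i x) x)"
      by (simp add: a(1) b(1) prod.distrib cong: restrict_cong)
    also have "\<dots> \<in> S"
      using a(2) b(2) by (intro SI vf_ker_mult vf) auto
    finally show ?thesis .
  qed
  have const_S: "(\<lambda>x\<in>X. 1) \<in> S"
  proof -
    have "(\<lambda>x\<in>X. 1) = (\<lambda>x\<in>X. \<Prod>i<length \<theta>s. (\<lambda>x\<in>X. 1) x)"
      by (simp cong: restrict_cong)
    also have "\<dots> \<in> S"
      by (intro SI vf_ker_const vf) auto
    finally show ?thesis .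
  qed
  have ker_S: "f \<in> S" if f: "f \<in> vf_ker X \<theta>" and "\<theta> \<in> set \<theta>s" for f \<theta>
  proof -
    obtain k where k: "k < length \<theta>s" "\<theta>s ! k = \<theta>"
      using \<open>\<theta> \<in> set \<theta>s\<close> by (auto simp: in_set_conv_nth)
    \<comment> \<open>\<open>f\<close> occupies slot \<open>k\<close> and the constant 1 fills the
      others.\<close>
    have "f = (\<lambda>x\<in>X. \<Prod>i<length \<theta>s. if i = k then f x else 1)"
      using f k(1) by (simp add: vf_ker_def regular_functions_extensional)
    also have "\<dots> = (\<lambda>x\<in>X. \<Prod>i<length \<theta>s. (if i = k then f else (\<lambda>x\<in>X. 1)) x)"
      by (intro restrict_ext prod.cong) auto
    also have "\<dots> \<in> S"
      using f k by (intro SI) (auto simp: vf_ker_const vf)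
    finally show ?thesis .
  qed
  have "restrict F X \<in> linear_span_on X S" if "complex_polynomial_function F" for F
    using that
  proof induction
    case (const c)
    have "(\<lambda>x\<in>X. c * (\<lambda>x\<in>X. 1) x) \<in> linear_span_on X S"
      by (intro linear_span_on_scale linear_span_on_base const_S restrict_extensional)
    also have "(\<lambda>x\<in>X. c * (\<lambda>x\<in>X. 1) x) = (\<lambda>x\<in>X. c)"
      by (intro restrict_ext) simp
    finally show ?case .
  next
    case (coord j)
    obtain \<theta> where \<theta>: "\<theta> \<in> set \<theta>s" "(\<lambda>x\<in>X. x $ j) \<in> vf_ker X \<theta>"
      using assms(2) by blast
    show ?case
      by (rule linear_span_on_base[OF ker_S[OF \<theta>(2,1)] restrict_extensional])
  next
    case (add f g)
    then have "(\<lambda>x\<in>X. restrict f X x + restrict g X x) \<in> linear_span_on X S"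
      by (intro linear_span_on_add)
    also have "(\<lambda>x\<in>X. restrict f X x + restrict g X x) = (\<lambda>x\<in>X. f x + g x)"
      by (intro restrict_ext) simp
    finally show ?case .
  next
    case (mult f g)
    then have "(\<lambda>x\<in>X. restrict f X x * restrict g X x) \<in> linear_span_on X S"
      by (intro linear_span_on_mult S_mult)
    also have "(\<lambda>x\<in>X. restrict f X x * restrict g X x) = (\<lambda>x\<in>X. f x * g x)"
      by (intro restrict_ext) simp
    finally show ?case .
  qed
  then show ?thesis
    unfolding S_def by (blast elim: regular_functionsE)
qed

section \<open>The Danielewski surface\<close>

definition danielewski_equation :: "complex poly \<Rightarrow> complex ^ 3 \<Rightarrow> complex" where
  "danielewski_equation p v = v $ 1 * v $ 2 - poly p (v $ 3)"

lemma complex_polynomial_function_danielewski_equation: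
  "complex_polynomial_function (danielewski_equation p)"
  unfolding danielewski_equation_def
  by (intro complex_polynomial_function_diff complex_polynomial_function_poly
      complex_polynomial_function.intros)

lemma danielewski_eq_zeros: "danielewski p = {v. danielewski_equation p v = 0}"
  by (auto simp: danielewski_def danielewski_equation_def)

lemma partial_deriv_danielewski_equation:
  "partial_deriv 1 (danielewski_equation p) v = v $ 2"
  "partial_deriv 2 (danielewski_equation p) v = v $ 1"
  "partial_deriv 3 (danielewski_equation p) v = - poly (pderiv p) (v $ 3)"
  unfolding danielewski_equation_def
  by (simp_all add: partial_deriv_diff partial_deriv_mult partial_deriv_poly_coord
      complex_polynomial_function.intros complex_polynomial_function_poly)

text \<open>The gradient of the equation is (y, x, -p'(z)). If x = y = 0 at a point of the surface,
  then p(z) = 0, and simplicity of the zero gives p'(z) \<noteq> 0; so the gradient never vanishes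
  on the surface.\<close>

lemma algebraic_manifold_danielewski:
  assumes "rsquarefree p"
  shows "algebraic_manifold (danielewski p)"
  unfolding algebraic_manifold_def
proof (intro conjI ballI)
  show "affine_algebraic_set (danielewski p)"
    unfolding affine_algebraic_set_def danielewski_eq_zeros
    by (intro exI[of _ "{danielewski_equation p}"])
      (auto simp: complex_polynomial_function_danielewski_equation)
next
  fix v assume v: "v \<in> danielewski p"
  have "v $ 1 \<noteq> 0 \<or> v $ 2 \<noteq> 0 \<or> poly (pderiv p) (v $ 3) \<noteq> 0"
    using v assms by (auto simp: danielewski_def rsquarefree_roots)
  then obtain i where "partial_deriv i (danielewski_equation p) v \<noteq> 0"
    using partial_deriv_danielewski_equation by (metis neg_equal_0_iff_equal)
  then show "smooth_point (danielewski p) v"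
    unfolding smooth_point_def
    \<comment> \<open>One equation cuts out the surface globally, and linear independence of a
      single gradient means that it is non-zero.\<close>
    by (intro exI[of _ UNIV] exI[of _ "{danielewski_equation p}"])
      (auto simp: complex_polynomial_function_danielewski_equation vanishing_ideal_def
        danielewski_eq_zeros)
qed

section \<open>Completeness by explicit integral curves\<close>

lemma complete_theta1: "complete_vector_field (danielewski p) (theta1 p)"
  unfolding complete_vector_field_def
proof
  fix v assume v: "v \<in> danielewski p"
  \<comment> \<open>The flow scales x and y by reciprocal factors, so xy and z are
    conserved.\<close>
  define \<phi> :: "complex \<Rightarrow> complex ^ 3"
    where "\<phi> t = vector [v $ 1 * exp t, v $ 2 * exp (- t), v $ 3]" for t
  have mem: "\<phi> t \<in> danielewski p" for t
    using v by (simp add: \<phi>_def danielewski_def exp_minus field_simps)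
  have "\<phi> 0 = v"
    by (simp add: \<phi>_def vec_eq_iff forall_3)
  moreover have "((\<lambda>s. \<phi> s $ i) has_field_derivative theta1 p (\<phi> t) $ i) (at t)" for t i
    using exhaust_3[of i] mem[of t]
    by (auto simp: theta1_def) (auto simp: \<phi>_def intro!: derivative_eq_intros)
  ultimately show "\<exists>\<phi>. \<phi> 0 = v \<and> (\<forall>t. \<phi> t \<in> danielewski p) \<and>
      (\<forall>t i. ((\<lambda>s. \<phi> s $ i) has_field_derivative theta1 p (\<phi> t) $ i) (at t))"
    using mem by blast
qed

text \<open>Along an integral curve of \<open>\<theta>\<^sub>2\<close>, \<open>y\<close> is constant and \<open>z\<close> is affine in time; \<open>x\<close> is then
  \<open>p(z)/y\<close>, unless \<open>y = 0\<close>, when \<open>z\<close> is constant too.\<close>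

lemma complete_theta2: "complete_vector_field (danielewski p) (theta2 p)"
  unfolding complete_vector_field_def
proof
  fix v assume v: "v \<in> danielewski p"
  define \<phi> :: "complex \<Rightarrow> complex ^ 3" where "\<phi> t = vector
    [if v $ 2 = 0 then v $ 1 + t * poly (pderiv p) (v $ 3) else poly p (v $ 3 + t * v $ 2) / v $ 2,
     v $ 2, v $ 3 + t * v $ 2]" for t
  have mem: "\<phi> t \<in> danielewski p" for t
    using v by (auto simp: \<phi>_def danielewski_def)
  have "\<phi> 0 = v"
    using v by (auto simp: \<phi>_def vec_eq_iff forall_3 danielewski_def field_simps)
  \<comment> \<open>For y \<noteq> 0 the inner derivative of p(z + ty) contributes a factor y that
    cancels the denominator; for y = 0 the x-velocity is the constant p'(z).\<close>
  moreover have "((\<lambda>s. \<phi> s $ i) has_field_derivative theta2 p (\<phi> t) $ i) (at t)" for t i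
    using exhaust_3[of i] mem[of t]
    by (cases "v $ 2 = 0")
      (auto simp: theta2_def, auto simp: \<phi>_def intro!: derivative_eq_intros)
  ultimately show "\<exists>\<phi>. \<phi> 0 = v \<and> (\<forall>t. \<phi> t \<in> danielewski p) \<and>
      (\<forall>t i. ((\<lambda>s. \<phi> s $ i) has_field_derivative theta2 p (\<phi> t) $ i) (at t))"
    using mem by blast
qed

text \<open>Exchanging x and y preserves the surface and turns the second field into the third, so
  the curves are those of \<open>theta2\<close> with x and y exchanged.\<close>

lemma complete_theta3: "complete_vector_field (danielewski p) (theta3 p)"
  unfolding complete_vector_field_def
proof
  fix v assume v: "v \<in> danielewski p"
  define \<phi> :: "complex \<Rightarrow> complex ^ 3" where "\<phi> t = vector
    [v $ 1,
     if v $ 1 = 0 then v $ 2 + t * poly (pderiv p) (v $ 3) else poly p (v $ 3 + t * v $ 1) / v $ 1,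
     v $ 3 + t * v $ 1]" for t
  have mem: "\<phi> t \<in> danielewski p" for t
    using v by (auto simp: \<phi>_def danielewski_def)
  have "\<phi> 0 = v"
    using v by (auto simp: \<phi>_def vec_eq_iff forall_3 danielewski_def field_simps)
  moreover have "((\<lambda>s. \<phi> s $ i) has_field_derivative theta3 p (\<phi> t) $ i) (at t)" for t i
    using exhaust_3[of i] mem[of t]
    by (cases "v $ 1 = 0")
      (auto simp: theta3_def, auto simp: \<phi>_def intro!: derivative_eq_intros)
  ultimately show "\<exists>\<phi>. \<phi> 0 = v \<and> (\<forall>t. \<phi> t \<in> danielewski p) \<and>
      (\<forall>t i. ((\<lambda>s. \<phi> s $ i) has_field_derivative theta3 p (\<phi> t) $ i) (at t))"
    using mem by blast
qed

section \<open>Algebraicity of the three fields\<close>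

lemma algebraic_theta1: "algebraic_vector_field (danielewski p) (theta1 p)"
proof (rule algebraic_vector_field_if_complete[OF _ _ complete_theta1])
  fix i :: 3
  \<comment> \<open>The coefficient -y is obtained as the difference 0 - y.\<close>
  have "complex_polynomial_function 
      (\<lambda>v :: complex ^ 3. vector [v $ 1, - v $ 2, 0] $ i)"
    using exhaust_3[of i]
    by (auto simp: complex_polynomial_function.const complex_polynomial_function.coord
        complex_polynomial_function_diff[OF complex_polynomial_function.const[of 0]
          complex_polynomial_function.coord, simplified])
  from regular_functionsI[OF this, of "danielewski p"]
  show "(\<lambda>v\<in>danielewski p. theta1 p v $ i) \<in> regular_functions (danielewski p)"
    by (simp add: theta1_def cong: restrict_cong)
qed (simp add: theta1_def)

lemma algebraic_theta2: "algebraic_vector_field (danielewski p) (theta2 p)"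
proof (rule algebraic_vector_field_if_complete[OF _ _ complete_theta2])
  fix i :: 3
  have "complex_polynomial_function
      (\<lambda>v :: complex ^ 3. vector [poly (pderiv p) (v $ 3), 0, v $ 2] $ i)"
    using exhaust_3[of i]
    by (auto simp: complex_polynomial_function.const complex_polynomial_function.coord
        complex_polynomial_function_poly[OF complex_polynomial_function.coord])
  from regular_functionsI[OF this, of "danielewski p"]
  show "(\<lambda>v\<in>danielewski p. theta2 p v $ i) \<in> regular_functions (danielewski p)"
    by (simp add: theta2_def cong: restrict_cong)
qed (simp add: theta2_def)

lemma algebraic_theta3: "algebraic_vector_field (danielewski p) (theta3 p)"
proof (rule algebraic_vector_field_if_complete[OF _ _ complete_theta3])
  fix i :: 3
  have "complex_polynomial_function
      (\<lambda>v :: complex ^ 3. vector [0, poly (pderiv p) (v $ 3), v $ 1] $ i)"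
    using exhaust_3[of i]
    by (auto simp: complex_polynomial_function.const complex_polynomial_function.coord
        complex_polynomial_function_poly[OF complex_polynomial_function.coord])
  from regular_functionsI[OF this, of "danielewski p"]
  show "(\<lambda>v\<in>danielewski p. theta3 p v $ i) \<in> regular_functions (danielewski p)"
    by (simp add: theta3_def cong: restrict_cong)
qed (simp add: theta3_def)

section \<open>Coordinates in the kernels of the fields and of their squares\<close>

lemma vf_apply_coord:
  assumes "algebraic_vector_field X \<theta>"
  shows "vf_apply X \<theta> (\<lambda>v\<in>X. v $ j) = (\<lambda>v\<in>X. \<theta> v $ j)"
  by (simp add: vf_apply_restrict[OF assms complex_polynomial_function.coord])

lemma coord_in_vf_ker_iff:
  assumes "algebraic_vector_field X \<theta>"
  shows "(\<lambda>v\<in>X. v $ j) \<in> vf_ker X \<theta> \<longleftrightarrow> (\<forall>v\<in>X. \<theta> v $ j = 0)"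
  by (simp add: restrict_in_vf_ker_iff[OF assms complex_polynomial_function.coord])

text \<open>The field maps coordinate \<open>j\<close> to coordinate \<open>k\<close> and the latter
  to 0; this fits z, y under \<open>theta2\<close> and z, x under \<open>theta3\<close>.\<close>

lemma coord_in_vf_ker2I:
  assumes "algebraic_vector_field X \<theta>"
    and "\<And>v. v \<in> X \<Longrightarrow> \<theta> v $ j = v $ k" "\<And>v. v \<in> X \<Longrightarrow> \<theta> v $ k = 0"
  shows "(\<lambda>v\<in>X. v $ j) \<in> vf_ker2 X \<theta>"
  using assms(2,3)
  by (simp add: vf_ker2_def vf_apply_coord[OF assms(1)] regular_functionsI
      complex_polynomial_function.coord cong: restrict_cong)

text \<open>Points over z = 0 that exist for every \<open>p\<close>: one of x, y is fixed as 1 or 2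
  and the equation is solved for the other. They witness that x and y are not identically zero and
  that the surface is non-empty.\<close>

lemma danielewski_points:
  "vector [poly p 0, 1, 0] \<in> danielewski p"
  "vector [1, poly p 0, 0] \<in> danielewski p"
  "vector [poly p 0 / 2, 2, 0] \<in> danielewski p"
  by (simp_all add: danielewski_def)

text \<open>Needed for the bijection between vertices and fields. The z-coefficients of the three
  fields are 0, y and x, which differ as functions on the surface.\<close>

lemma theta_distinct: "distinct [theta1 p, theta2 p, theta3 p]"
proof -
  have "theta1 p (vector [poly p 0, 1, 0]) $ 3 \<noteq> theta2 p (vector [poly p 0, 1, 0]) $ 3"
    "theta1 p (vector [1, poly p 0, 0]) $ 3 \<noteq> theta3 p (vector [1, poly p 0, 0]) $ 3"
    by (simp_all add: theta1_def theta2_def theta3_def danielewski_points)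
  moreover have "theta2 p \<noteq> theta3 p"
  proof
    assume eq: "theta2 p = theta3 p"
    have "v $ 2 = v $ 1" if "v \<in> danielewski p" for v
      using fun_cong[OF eq, of v] that by (auto simp: theta2_def theta3_def vec_eq_iff forall_3)
    \<comment> \<open>The first point would force p(0) = 1, the third p(0) = 4.\<close>
    from this[OF danielewski_points(1)] this[OF danielewski_points(3)] show False
      by (simp add: field_simps)
  qed
  ultimately show ?thesis
    by auto
qed

text \<open>The root has no outgoing arc, so only the empty walk leads from it to itself. A leaf has
  exactly one outgoing arc, and after it the walk can only stop.\<close>

lemma finite_tree_to_root_star:
  fixes r :: 'v
  assumes "finite L" "r \<notin> L"
  shows "finite_tree_to_root \<lparr>pverts = insert r L, parcs = L \<times> {r}\<rparr> r"
    (is "finite_tree_to_root ?G r")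
  unfolding finite_tree_to_root_def
proof (intro conjI ballI)
  show "pair_fin_digraph ?G"
    by unfold_locales (use assms in auto)
  show "r \<in> pverts ?G"
    by simp
  have root: "pre_digraph.awalk (with_proj ?G) r w r \<longleftrightarrow> w = []" for w
    using assms(2) by (cases w) (auto simp: pre_digraph.awalk_def pre_digraph.cas.simps)
  fix v assume v: "v \<in> pverts ?G"
  show "\<exists>!w. pre_digraph.awalk (with_proj ?G) v w r"
  proof (cases "v = r")
    case True
    then show ?thesis
      using root by simp
  next
    case False
    have "pre_digraph.awalk (with_proj ?G) v w r \<longleftrightarrow> w = [(v, r)]" for w
    proof (cases w)
      case Nil
      then show ?thesis
        using False by (auto simp: pre_digraph.awalk_def pre_digraph.cas.simps)
    next
      case (Cons e u)
      have "pre_digraph.awalk (with_proj ?G) v w r \<longleftrightarrow>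
          e = (v, r) \<and> pre_digraph.awalk (with_proj ?G) r u r"
        using False v unfolding Cons
        by (cases e) (auto simp: pre_digraph.awalk_def pre_digraph.cas.simps)
      then show ?thesis
        by (simp add: root Cons)
    qed
    then show ?thesis
      by simp
  qed
qed

theorem lemma4p1:
  fixes p :: "complex poly"
  assumes "rsquarefree p"
  shows "compatible_tuple (danielewski p) [theta1 p, theta2 p, theta3 p]"
proof -
  let ?X = "danielewski p" and ?\<theta>s = "[theta1 p, theta2 p, theta3 p]"
  let ?z = "\<lambda>v\<in>?X. v $ 3"
  have vf: "\<forall>\<theta>\<in>set ?\<theta>s. algebraic_vector_field ?X \<theta> \<and> complete_vector_field ?X \<theta>"
    by (simp add: algebraic_theta1 algebraic_theta2 algebraic_theta3
        complete_theta1 complete_theta2 complete_theta3)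
  have z1: "?z \<in> vf_ker ?X (theta1 p)"
    by (simp add: coord_in_vf_ker_iff algebraic_theta1) (simp add: theta1_def)
  have y2: "(\<lambda>v\<in>?X. v $ 2) \<in> vf_ker ?X (theta2 p)"
    by (simp add: coord_in_vf_ker_iff algebraic_theta2) (simp add: theta2_def)
  have x3: "(\<lambda>v\<in>?X. v $ 1) \<in> vf_ker ?X (theta3 p)"
    by (simp add: coord_in_vf_ker_iff algebraic_theta3) (simp add: theta3_def)
  have z2: "?z \<in> vf_ker2 ?X (theta2 p) - vf_ker ?X (theta2 p)"
  proof
    show "?z \<in> vf_ker2 ?X (theta2 p)"
      by (rule coord_in_vf_ker2I[OF algebraic_theta2, of p 3 2]) (simp_all add: theta2_def)
    \<comment> \<open>The z-coefficient y equals 1 at the first sample point.\<close>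
    show "?z \<notin> vf_ker ?X (theta2 p)"
      unfolding coord_in_vf_ker_iff[OF algebraic_theta2]
      using danielewski_points(1)[of p] by (auto simp: theta2_def intro!: bexI[rotated])
  qed
  have z3: "?z \<in> vf_ker2 ?X (theta3 p) - vf_ker ?X (theta3 p)"
  proof
    show "?z \<in> vf_ker2 ?X (theta3 p)"
      by (rule coord_in_vf_ker2I[OF algebraic_theta3, of p 3 1]) (simp_all add: theta3_def)
    show "?z \<notin> vf_ker ?X (theta3 p)"
      unfolding coord_in_vf_ker_iff[OF algebraic_theta3]
      using danielewski_points(2)[of p] by (auto simp: theta3_def intro!: bexI[rotated])
  qed
  \<comment> \<open>Vertices are positions in the list, so the labelling is list indexing and the
    root 0 carries the head \<open>theta1 p\<close>.\<close>
  let ?G = "\<lparr>pverts = insert 0 {1, 2}, parcs = {1, 2} \<times> {0}\<rparr> :: nat pair_pre_digraph"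
  have tree: "\<exists>(G :: nat pair_pre_digraph) r \<pi> \<epsilon>. finite_tree_to_root G r \<and>
      bij_betw \<pi> (pverts G) (set ?\<theta>s) \<and> \<pi> r = hd ?\<theta>s \<and>
      (\<forall>(v, w)\<in>parcs G.
         \<epsilon> (v, w) \<in> (vf_ker2 ?X (\<pi> v) - vf_ker ?X (\<pi> v)) \<inter> vf_ker ?X (\<pi> w))"
  proof (intro exI conjI)
    show "finite_tree_to_root ?G 0"
      by (rule finite_tree_to_root_star) auto
    have "pverts ?G = {..<length ?\<theta>s}"
      by auto
    then show "bij_betw ((!) ?\<theta>s) (pverts ?G) (set ?\<theta>s)"
      using bij_betw_nth[OF theta_distinct] by metis
    show "\<forall>(v, w)\<in>parcs ?G. (\<lambda>_. ?z) (v, w) \<in>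
        (vf_ker2 ?X (?\<theta>s ! v) - vf_ker ?X (?\<theta>s ! v)) \<inter> vf_ker ?X (?\<theta>s ! w)"
      using z1 z2 z3 by auto
  qed simp
  have "ideal (carrier (regular_ring ?X)) (regular_ring ?X)"
    by (rule ring.oneideal[OF ring_regular_ring])
  moreover have "carrier (regular_ring ?X) \<noteq> {\<zero>\<^bsub>regular_ring ?X\<^esub>}"
  proof -
    \<comment> \<open>Restrictions to an empty set would all coincide; a point of the surface
      separates 1 from 0.\<close>
    have "(\<lambda>v\<in>?X. 1) \<noteq> (\<lambda>v\<in>?X. 0 :: complex)"
      using danielewski_points(1)[of p] by (metis restrict_apply zero_neq_one)
    moreover have "(\<lambda>v\<in>?X. 1) \<in> carrier (regular_ring ?X)"
      by (simp add: regular_ring_def regular_functions_const)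
    ultimately show ?thesis
      by (auto simp: regular_ring_def)
  qed
  moreover have "carrier (regular_ring ?X) \<subseteq> linear_span_on ?X
      {\<lambda>x\<in>?X. \<Prod>i<length ?\<theta>s. f i x | f. \<forall>i<length ?\<theta>s. f i \<in> vf_ker ?X (?\<theta>s ! i)}"
  proof -
    have "\<exists>\<theta>\<in>set ?\<theta>s. (\<lambda>v\<in>?X. v $ j) \<in> vf_ker ?X \<theta>" for j
      using exhaust_3[of j] z1 y2 x3 by auto
    then show ?thesis
      using regular_functions_subset_span_ker_products[of ?\<theta>s ?X] vf
      by (simp add: regular_ring_def)
  qed
  ultimately show ?thesis
    unfolding compatible_tuple_def
    using algebraic_manifold_danielewski[OF assms] vf tree by blast
qed

end
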